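(* Let $n\ge 1$, let $\mathcal{A}$ be the $n$-dimensional null-filiform associative algebra over $\mathbb{C}$ with basis $e_1,\dots,e_n$, and let $P_0$ be a homogeneous operator of degree $0$ on $\mathcal{A}$ which is a Nijenhuis operator. Then there is $a\in\mathbb{C}$ such that $P_0(e_i)=a e_i$ for all $1\le i\le n$.
   Context: The $n$-dimensional null-filiform associative algebra $\mathcal{A}$ over $\mathbb{C}$ has basis $e_1,\dots,e_n$ and bilinear product $e_ie_j=e_{i+j}$ if $i+j\le n$, and $e_ie_j=0$ otherwise. A homogeneous operator of degree $0$ on $\mathcal{A}$ is a linear map $P_0$ with $P_0(e_i)=\psi(i)e_i$ for $1\le i\le n$, where $\psi:\mathbb{N}\to\mathbb{C}$ is a function. A Nijenhuis operator is a linear map $P:\mathcal{A}\to\mathcal{A}$ with $P(x)P(y)=P(xP(y)+P(x)y-P(xy))$ for all $x,y\in\mathcal{A}$. *)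

theory Defs
  imports "HOL-Analysis.Cartesian_Space"
begin

locale complex_associative_algebra = vector_space scale
  for scale :: "complex \<Rightarrow> 'a::ab_group_add \<Rightarrow> 'a" (infixr "*\<^sub>C" 75) +
  fixes mult :: "'a \<Rightarrow> 'a \<Rightarrow> 'a" (infixl "\<odot>" 70)
  assumes mult_linear_left: "Vector_Spaces.linear scale scale (\<lambda>x. x \<odot> y)"
    and mult_linear_right: "Vector_Spaces.linear scale scale (\<lambda>y. x \<odot> y)"
    and mult_assoc: "(x \<odot> y) \<odot> z = x \<odot> (y \<odot> z)"
begin

definition nijenhuis_operator :: "('a \<Rightarrow> 'a) \<Rightarrow> bool" where
  "nijenhuis_operator P \<longleftrightarrow>
     Vector_Spaces.linear scale scale P \<and>
     (\<forall>x y. P x \<odot> P y = P (x \<odot> P y + P x \<odot> y - P (x \<odot> y)))"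

end

text \<open>The basis vectors are \<open>e 1, \<dots>, e n\<close>; the values of \<open>e\<close> outside \<open>{1..n}\<close> are irrelevant.
  The underlying space is the whole type, so \<open>n\<close> is determined by the type and \<open>scale\<close>.\<close>

locale null_filiform_algebra = complex_associative_algebra scale mult
  for scale :: "complex \<Rightarrow> 'a::ab_group_add \<Rightarrow> 'a" (infixr "*\<^sub>C" 75)
    and mult :: "'a \<Rightarrow> 'a \<Rightarrow> 'a" (infixl "\<odot>" 70) +
  fixes n :: nat and e :: "nat \<Rightarrow> 'a"
  assumes inj_basis: "inj_on e {1..n}"
    and independent_basis: "\<not> dependent (e ` {1..n})"
    and span_basis: "span (e ` {1..n}) = UNIV"
    and mult_basis:
      "\<lbrakk>i \<in> {1..n}; j \<in> {1..n}\<rbrakk> \<Longrightarrow> e i \<odot> e j = (if i + j \<le> n then e (i + j) else 0)"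
begin

definition homogeneous_operator_0 :: "('a \<Rightarrow> 'a) \<Rightarrow> bool" where
  "homogeneous_operator_0 P \<longleftrightarrow>
     Vector_Spaces.linear scale scale P \<and>
     (\<exists>\<psi> :: nat \<Rightarrow> complex. \<forall>i\<in>{1..n}. P (e i) = \<psi> i *\<^sub>C e i)"

end

text \<open>Existence of the algebra in every dimension \<open>n \<ge> 1\<close>, realised on \<open>complex ^ 'n\<close>.\<close>

lemma null_filiform_algebra_exists:
  "\<exists>(mult :: complex ^ 'n \<Rightarrow> complex ^ 'n \<Rightarrow> complex ^ 'n) e.
     null_filiform_algebra (*s) mult CARD('n) e"
proof -
  let ?n = "CARD('n)"
  obtain f :: "nat \<Rightarrow> 'n" where f: "bij_betw f {1..?n} UNIV"
    using finite_same_card_bij[of "{1..?n}" "UNIV :: 'n set"] by auto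
  define g where "g = the_inv_into {1..?n} f"
  have inj: "inj_on f {1..?n}" and surj: "f ` {1..?n} = UNIV"
    using f by (auto simp: bij_betw_def)
  have gf: "g (f i) = i" if "i \<in> {1..?n}" for i
    using the_inv_into_f_f[OF inj that] by (simp add: g_def)
  have fg: "f (g k) = k" for k
    using f_the_inv_into_f[OF inj, of k] surj by (simp add: g_def)
  have gn: "g k \<in> {1..?n}" for k
    using the_inv_into_into[OF inj, of k "{1..?n}"] surj by (simp add: g_def)
  define e :: "nat \<Rightarrow> complex ^ 'n" where "e i = axis (f i) 1" for i
  define mult :: "complex ^ 'n \<Rightarrow> complex ^ 'n \<Rightarrow> complex ^ 'n" where
    "mult x y = (\<chi> k. \<Sum>a\<in>UNIV. \<Sum>b\<in>UNIV. if g a + g b = g k then x $ a * y $ b else 0)" for x y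
  have ft: "e i $ k = (if g k = i then 1 else 0)" if "i \<in> {1..?n}" for i k
    using gf[OF that] fg[of k] by (auto simp: e_def axis_def)
  have lin1: "Vector_Spaces.linear (*s) (*s) (\<lambda>x. mult x y)" for y
  proof unfold_locales
    show "mult (u + v) y = mult u y + mult v y" for u v
      unfolding mult_def vec_eq_iff plus_vec_def vec_lambda_beta sum.distrib[symmetric]
      by (intro allI sum.cong refl) (simp add: algebra_simps)
    show "mult (c *s u) y = c *s mult u y" for c u
      unfolding mult_def vec_eq_iff vector_scalar_mult_def vec_lambda_beta sum_distrib_left
      by (intro allI sum.cong refl) (simp add: algebra_simps)
  qed
  have lin2: "Vector_Spaces.linear (*s) (*s) (\<lambda>y. mult x y)" for x
  proof unfold_locales
    show "mult x (u + v) = mult x u + mult x v" for u v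
      unfolding mult_def vec_eq_iff plus_vec_def vec_lambda_beta sum.distrib[symmetric]
      by (intro allI sum.cong refl) (simp add: algebra_simps)
    show "mult x (c *s u) = c *s mult x u" for c u
      unfolding mult_def vec_eq_iff vector_scalar_mult_def vec_lambda_beta sum_distrib_left
      by (intro allI sum.cong refl) (simp add: algebra_simps)
  qed
  have eimg: "e ` {1..?n} = cart_basis"
  proof -
    have "e ` {1..?n} = (\<lambda>k. axis k 1) ` (f ` {1..?n})"
      by (simp add: e_def image_image)
    then show ?thesis
      unfolding surj by (auto simp: cart_basis_def)
  qed
  have mb: "mult (e i) (e j) = (if i + j \<le> ?n then e (i + j) else 0)"
    if ij: "i \<in> {1..?n}" "j \<in> {1..?n}" for i j
  proof -
    have "mult (e i) (e j) $ k = (if i + j = g k then 1 else 0)" for k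
    proof -
      have "mult (e i) (e j) $ k =
        (\<Sum>a\<in>UNIV. \<Sum>b\<in>UNIV. if a = f i then if b = f j then (if i + j = g k then 1 else 0) else 0 else 0)"
        unfolding mult_def vec_lambda_beta
        using gf[OF ij(1)] gf[OF ij(2)]
        by (intro sum.cong refl) (auto simp: e_def axis_def)
      also have "\<dots> = (\<Sum>a\<in>UNIV. if a = f i then (\<Sum>b\<in>UNIV. if b = f j then (if i + j = g k then 1 else 0) else 0) else 0)"
        by (intro sum.cong refl) auto
      also have "\<dots> = (if i + j = g k then 1 else 0)"
        by (simp add: sum.delta)
      finally show ?thesis .
    qed
    then show ?thesis
      using ij gn by (auto simp: vec_eq_iff ft)
  qed
  have assoc: "mult (mult x y) z = mult x (mult y z)" for x y z
  proof -
    note closed = vec.linear_add[OF lin1] vec.linear_scale[OF lin1] vec.linear_0[OF lin1]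
      vec.linear_add[OF lin2] vec.linear_scale[OF lin2] vec.linear_0[OF lin2]
    have sp: "v \<in> vec.span (e ` {1..?n})" for v
      unfolding eimg by (simp add: span_cart_basis)
    have 1: "mult (mult (e i) (e j)) (e k) = mult (e i) (mult (e j) (e k))"
      if "i \<in> {1..?n}" "j \<in> {1..?n}" "k \<in> {1..?n}" for i j k
      using that by (auto simp: mb closed add.assoc)
    have ext: "F v = G v"
      if F: "Vector_Spaces.linear (*s) (*s) F" and G: "Vector_Spaces.linear (*s) (*s) G"
        and eq: "\<And>i. i \<in> {1..?n} \<Longrightarrow> F (e i) = G (e i)"
      for F G :: "complex ^ 'n \<Rightarrow> complex ^ 'n" and v
      by (rule vec.linear_eq_on[OF F G sp[of v]]) (use eq in blast)
    have ll: "Vector_Spaces.linear (*s) (*s) (\<lambda>x. mult (mult x y) z)"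
      and lm: "Vector_Spaces.linear (*s) (*s) (\<lambda>y. mult (mult x y) z)"
      and rm: "Vector_Spaces.linear (*s) (*s) (\<lambda>y. mult x (mult y z))"
      and rr: "Vector_Spaces.linear (*s) (*s) (\<lambda>z. mult x (mult y z))" for x y z
      by (unfold_locales; simp add: closed)+
    have 2: "mult (mult (e i) (e j)) z = mult (e i) (mult (e j) z)"
      if "i \<in> {1..?n}" "j \<in> {1..?n}" for i j z
      using ext[of "mult (mult (e i) (e j))" "\<lambda>z. mult (e i) (mult (e j) z)" z,
          OF lin2 rr] 1 that by simp
    have 3: "mult (mult (e i) y) z = mult (e i) (mult y z)"
      if "i \<in> {1..?n}" for i y z
      using ext[of "\<lambda>y. mult (mult (e i) y) z" "\<lambda>y. mult (e i) (mult y z)" y,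
          OF lm rm] 2 that by simp
    show "mult (mult x y) z = mult x (mult y z)"
      using ext[of "\<lambda>x. mult (mult x y) z" "\<lambda>x. mult x (mult y z)" x,
          OF ll lin1] 3 by simp
  qed
  have "null_filiform_algebra (*s) mult ?n e"
  proof (intro null_filiform_algebra.intro complex_associative_algebra.intro
      complex_associative_algebra_axioms.intro null_filiform_algebra_axioms.intro)
    show "vector_space ((*s) :: complex \<Rightarrow> complex ^ 'n \<Rightarrow> _)"
      by (rule vec.vector_space_axioms)
    show "inj_on e {1..?n}"
      by (rule inj_onI) (simp add: e_def axis_eq_axis inj_on_eq_iff[OF inj])
    show "vec.independent (e ` {1..?n})"
      unfolding eimg by (rule independent_cart_basis)
    show "vec.span (e ` {1..?n}) = UNIV"
      unfolding eimg by (rule span_cart_basis)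
    show "Vector_Spaces.linear (*s) (*s) (\<lambda>x. mult x y)" for y
      by (fact lin1)
    show "Vector_Spaces.linear (*s) (*s) (\<lambda>y. mult x y)" for x
      by (fact lin2)
    show "mult (mult x y) z = mult x (mult y z)" for x y z
      by (fact assoc)
    show "mult (e i) (e j) = (if i + j \<le> ?n then e (i + j) else 0)"
      if "i \<in> {1..?n}" "j \<in> {1..?n}" for i j
      using that by (fact mb)
  qed
  then show ?thesis by blast
qed

end

theory Submission
  imports Defs
begin

text \<open>If \<open>P (e i) = \<psi> i e i\<close>, comparing coefficients of \<open>e (i + j)\<close> in the Nijenhuis identity for
  \<open>e i\<close>, \<open>e j\<close> gives \<open>(\<psi> (i + j) - \<psi> i) (\<psi> (i + j) - \<psi> j) = 0\<close>. With \<open>j = 1\<close> this says that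
  \<open>\<psi> (i + 1)\<close> is \<open>\<psi> i\<close> or \<open>\<psi> 1\<close>, so \<open>\<psi>\<close> is constantly \<open>\<psi> 1\<close> on \<open>{1..n}\<close> by induction.\<close>

context null_filiform_algebra
begin

text \<open>An independent set cannot contain 0. This is what allows coefficients of a basis vector
  to be compared.\<close>

lemma basis_nonzero:
  assumes "i \<in> {1..n}"
  shows "e i \<noteq> 0"
  using assms independent_basis dependent_zero by (metis imageI)

lemma mult_scale_left: "(c *\<^sub>C x) \<odot> y = c *\<^sub>C (x \<odot> y)"
  using mult_linear_left by (rule module_hom.scale[OF module_hom_linearI])

lemma mult_scale_right: "x \<odot> (c *\<^sub>C y) = c *\<^sub>C (x \<odot> y)"
  using mult_linear_right by (rule module_hom.scale[OF module_hom_linearI])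

lemma nijenhuis_eigenvalue_add:
  assumes nij: "nijenhuis_operator P"
    and eig: "\<And>i. i \<in> {1..n} \<Longrightarrow> P (e i) = \<psi> i *\<^sub>C e i"
    and ij: "i \<ge> 1" "j \<ge> 1" "i + j \<le> n"
  shows "\<psi> (i + j) = \<psi> i \<or> \<psi> (i + j) = \<psi> j"
proof -
  have lin: "Vector_Spaces.linear scale scale P"
    and nij_eq: "P (e i) \<odot> P (e j) = P (e i \<odot> P (e j) + P (e i) \<odot> e j - P (e i \<odot> e j))"
    using nij by (auto simp: nijenhuis_operator_def)
  have P_scale: "P (c *\<^sub>C x) = c *\<^sub>C P x" for c x
    using lin by (rule module_hom.scale[OF module_hom_linearI])
  have "(\<psi> i * \<psi> j) *\<^sub>C e (i + j) = P (e i) \<odot> P (e j)"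
    using ij by (simp add: eig mult_basis mult_scale_left mult_scale_right)
  \<comment> \<open>All three terms in the argument of \<open>P\<close> are multiples of
    \<open>e (i + j)\<close>, so \<open>P\<close> acts on it by the single eigenvalue
    \<open>\<psi> (i + j)\<close>.\<close>
  also have "\<dots> = P ((\<psi> j + \<psi> i - \<psi> (i + j)) *\<^sub>C e (i + j))"
    unfolding nij_eq using ij
    by (simp add: eig mult_basis mult_scale_left mult_scale_right scale_left_distrib
        scale_left_diff_distrib)
  also have "\<dots> = ((\<psi> j + \<psi> i - \<psi> (i + j)) * \<psi> (i + j)) *\<^sub>C e (i + j)"
    using ij by (simp add: P_scale eig)
  \<comment> \<open>Cancelling needs \<open>e (i + j)\<close> to be nonzero, which holds since
    \<open>i + j \<le> n\<close>.\<close>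
  finally have "\<psi> i * \<psi> j = (\<psi> j + \<psi> i - \<psi> (i + j)) * \<psi> (i + j)"
    using basis_nonzero[of "i + j"] ij by simp
  \<comment> \<open>As a quadratic in \<open>\<psi> (i + j)\<close>, the equation has the roots
    \<open>\<psi> i\<close> and \<open>\<psi> j\<close>.\<close>
  then have "(\<psi> (i + j) - \<psi> i) * (\<psi> (i + j) - \<psi> j) = 0"
    by (simp add: algebra_simps)
  then show ?thesis by simp
qed

lemma nijenhuis_homogeneous_0_scalar:
  assumes nij: "nijenhuis_operator P" and hom: "homogeneous_operator_0 P"
  shows "\<exists>a. \<forall>i\<in>{1..n}. P (e i) = a *\<^sub>C e i"
proof -
  obtain \<psi> where "\<forall>i\<in>{1..n}. P (e i) = \<psi> i *\<^sub>C e i"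
    using hom unfolding homogeneous_operator_0_def by (elim conjE exE)
  then have eig: "P (e i) = \<psi> i *\<^sub>C e i" if "i \<in> {1..n}" for i
    using that by (rule bspec)
  have "\<psi> i = \<psi> 1" if "1 \<le> i" "i \<le> n" for i
    using that
  proof (induction i rule: dec_induct)
    case (step i)
    \<comment> \<open>Both alternatives give \<open>\<psi> 1\<close>, the first by the induction
      hypothesis.\<close>
    then show ?case
      using nijenhuis_eigenvalue_add[OF nij eig, of i 1] by auto
  qed simp
  then have "P (e i) = \<psi> 1 *\<^sub>C e i" if "i \<in> {1..n}" for i
    using that by (metis eig atLeastAtMost_iff)
  then show ?thesis by blast
qed

end

theorem theorem3p13:
  fixes scale :: "complex \<Rightarrow> 'a::ab_group_add \<Rightarrow> 'a"
    and mult :: "'a \<Rightarrow> 'a \<Rightarrow> 'a"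
    and n :: nat
    and e :: "nat \<Rightarrow> 'a"
    and P\<^sub>0 :: "'a \<Rightarrow> 'a"
  assumes "n \<ge> 1"
    and "null_filiform_algebra scale mult n e"
    and "null_filiform_algebra.homogeneous_operator_0 scale n e P\<^sub>0"
    and "complex_associative_algebra.nijenhuis_operator scale mult P\<^sub>0"
  shows "\<exists>a::complex. \<forall>i\<in>{1..n}. P\<^sub>0 (e i) = scale a (e i)"
  using null_filiform_algebra.nijenhuis_homogeneous_0_scalar[OF assms(2,4,3)] .

end
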